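(* Let $h,m,n,a$ be positive integers. Then: (i) if $h>1$, \[ \frac{1}{n(n+1)(n+2)}\sum_{k=1}^{n}(-1)^{k}k^a(k+1)^a(2k+1)D_{k}^{(h)}(x)^{m}\in\mathbb{Z}[x]; \] (ii) \[ \frac{\gcd(2,m-1,n)}{n(n+1)(n+2)}\sum_{k=1}^{n}(-1)^{k}k^a(k+1)^a(2k+1)D_{k}(x)^{m}\in\mathbb{Z}[x]. \]
   Context: For $h\in\mathbb{Z}^{+}$ and $n\in\mathbb{N}$, $D_n^{(h)}(x)=\sum_{k=0}^{n}\binom{n+k}{2k}^{h}\binom{2k}{k}^{h}x^{k}$, and $D_n(x)=D_n^{(1)}(x)=\sum_{k=0}^{n}\binom{n}{k}\binom{n+k}{k}x^k$ is the Delannoy polynomial. $\gcd(2,m-1,n)$ denotes the greatest common divisor of $2$, $m-1$ and $n$. *)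

theory Defs
  imports Complex_Main "HOL-Computational_Algebra.Polynomial"
begin

definition gen_delannoy :: "nat \<Rightarrow> nat \<Rightarrow> rat poly" where
  "gen_delannoy h n =
     (\<Sum>k=0..n. monom (of_nat (((n + k) choose (2 * k)) ^ h * ((2 * k) choose k) ^ h)) k)"

definition delannoy :: "nat \<Rightarrow> rat poly" where
  "delannoy n = (\<Sum>k=0..n. monom (of_nat ((n choose k) * ((n + k) choose k))) k)"

lemma delannoy_eq_gen_delannoy: "delannoy n = gen_delannoy 1 n"
proof -
  have "(n choose k) * ((n + k) choose k) = ((n + k) choose (2 * k)) * ((2 * k) choose k)"
    if "k \<le> n" for k
    using choose_mult[of k "2 * k" "n + k"] that by (simp add: mult.commute mult_2)
  then show ?thesis
    unfolding delannoy_def gen_delannoy_def by (intro sum.cong refl) simp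
qed

text \<open>The subring \<open>\<int>[x]\<close> of \<open>\<rat>[x]\<close>.\<close>
definition int_polys :: "rat poly set" where
  "int_polys = range (map_poly of_int)"

end

theory Submission
  imports Defs
begin

text \<open>
  Put \<open>w = k (k + 1)\<close> and \<open>b\<^sub>l(k) = (k choose l) (k + l choose l)\<close>, a polynomial of degree \<open>l\<close> in
  \<open>w\<close> satisfying \<open>w b\<^sub>l = (l + 1)^2 b\<^sub>l\<^sub>+\<^sub>1 + l (l + 1) b\<^sub>l\<close>. The integral span \<open>B\<close> of the \<open>b\<^sub>l\<close> is a ring,
  and the coefficients of \<open>b\<^sub>l^2\<close> are multiples of the central binomial coefficient, so that
  \<open>b\<^sub>l^2 \<in> 2 B\<close> for \<open>l > 0\<close>.
  The alternating sum of \<open>w (2 k + 1) b\<^sub>l(k)\<close> over \<open>k \<le> n\<close> has a closed form, which shows that twice it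
  is divisible by \<open>n (n + 1) (n + 2)\<close>; the factor two is superfluous if \<open>n\<close> is odd or \<open>l \<le> 1\<close>.
  Hence only even \<open>n\<close> needs care, and there it suffices that \<open>D\<^sub>k^m\<close> (with \<open>m\<close> even or \<open>h > 1\<close>) lies
  in the ring of constants plus \<open>2 B\<close>, while \<open>w^(a - 1)\<close> is \<open>1\<close>, \<open>b\<^sub>1\<close> or in \<open>2 B\<close>.
\<close>

section \<open>The basis \<open>dbasis\<close> and its product formula\<close>

definition dbasis :: "nat \<Rightarrow> nat \<Rightarrow> nat" where
  "dbasis l k = (k choose l) * ((k + l) choose l)"

lemma dbasis_0 [simp]: "dbasis 0 k = 1"
  by (simp add: dbasis_def)

lemma dbasis_1: "dbasis 1 k = k * (k + 1)"
  by (simp add: dbasis_def)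

lemma dbasis_eq_0: "k < l \<Longrightarrow> dbasis l k = 0"
  by (simp add: dbasis_def)

lemma dbasis_alt: "l \<le> k \<Longrightarrow> dbasis l k = ((k + l) choose (2 * l)) * ((2 * l) choose l)"
  using choose_mult[of l "2 * l" "k + l"] by (simp add: dbasis_def mult.commute mult_2)

text \<open>Stated over the integers because natural subtraction would truncate; for
  \<open>k > n\<close> both sides vanish.\<close>

lemma int_choose_Suc: "(int k + 1) * int (n choose Suc k) = (int n - int k) * int (n choose k)"
proof (cases "k \<le> n")
  case True
  have "Suc k * (n choose Suc k) = (n - k) * (n choose k)"
    by (simp only: binomial_absorb_comp binomial_absorption times_binomial_minus1_eq)
  then have "int (Suc k * (n choose Suc k)) = int ((n - k) * (n choose k))" by (rule arg_cong)
  with True show ?thesis by (simp add: of_nat_diff algebra_simps)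
qed (simp add: binomial_eq_0)

lemma int_Suc_choose: "(int n + 1 - int k) * int (Suc n choose k) = (int n + 1) * int (n choose k)"
proof (cases k)
  case (Suc r)
  then show ?thesis
    using int_choose_Suc[of r n] by (simp add: algebra_simps)
qed simp

lemma int_Suc_choose_Suc:
  "(int k + 1) * int (Suc n choose Suc k) = (int n + 1) * int (n choose k)"
  using arg_cong[OF Suc_times_binomial[of k n], of int] by (simp add: algebra_simps)

text \<open>Raising \<open>l\<close> contributes the factors \<open>k - l\<close> and
  \<open>k + l + 1\<close>, whose product is \<open>k * (k + 1) - l * (l + 1)\<close>.\<close>

lemma dbasis_Suc:
  "(int l + 1)\<^sup>2 * int (dbasis (Suc l) k) =
     (int k * (int k + 1) - int l * (int l + 1)) * int (dbasis l k)"
proof -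
  have *: "(int l + 1) * int (Suc (k + l) choose Suc l) = (int k + int l + 1) * int ((k + l) choose l)"
    using int_Suc_choose_Suc[of l "k + l"] by simp
  have "(int l + 1)\<^sup>2 * int (dbasis (Suc l) k) =
      ((int l + 1) * int (k choose Suc l)) * ((int l + 1) * int (Suc (k + l) choose Suc l))"
    by (simp add: dbasis_def power2_eq_square del: binomial_Suc_Suc)
  also have "\<dots> = (int k - int l) * int (k choose l) * ((int k + int l + 1) * int ((k + l) choose l))"
    by (simp only: int_choose_Suc[of l k] *)
  finally show ?thesis by (simp add: dbasis_def algebra_simps)
qed

text \<open>This and the next lemma give the recursion in \<open>j\<close>, cleared of denominators,
  of the coefficients in \<open>dbasis_mult_int\<close>: first for the index 0, then for
  \<open>Suc t\<close>.\<close>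

lemma dbasis_coeff_rec_0:
  "(int j + 1)\<^sup>2 * (int (Suc (i + j) choose i) * int (i choose Suc j)) =
     int ((i + j) choose i) * int (i choose j) * (int i * (int i + 1) - int j * (int j + 1))"
proof -
  have "(int j + 1) * int (Suc (i + j) choose i) = (int i + int j + 1) * int ((i + j) choose i)"
    using int_Suc_choose[of "i + j" i] by (simp add: algebra_simps del: binomial_Suc_Suc)
  moreover have "(int j + 1)\<^sup>2 * (int (Suc (i + j) choose i) * int (i choose Suc j)) =
     ((int j + 1) * int (Suc (i + j) choose i)) * ((int j + 1) * int (i choose Suc j))"
    by (simp add: power2_eq_square)
  ultimately show ?thesis
    by (simp only: int_choose_Suc) (simp add: algebra_simps)
qed

lemma dbasis_coeff_rec_Suc:
  fixes i j t :: nat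
  defines "s \<equiv> i + Suc t"
  shows "(int j + 1)\<^sup>2 * (int (Suc (i + j) choose i) * int (Suc j choose Suc t) * int (s choose Suc j)) =
     int ((i + j) choose i) * int (j choose t) * int ((i + t) choose j) * (int s)\<^sup>2 +
     int ((i + j) choose i) * int (j choose Suc t) * int (s choose j) *
       (int s * (int s + 1) - int j * (int j + 1))"
proof -
  define A where "A = int ((i + j) choose i)"
  \<comment> \<open>By facts 2 and 3 both terms on the right carry this factor, so that only
    identity 6 remains.\<close>
  define C where "C = (int j + 1) * int (s choose Suc j)"
  have 1: "(int j + 1) * int (Suc (i + j) choose i) = (int i + int j + 1) * A"
    using int_Suc_choose[of "i + j" i] by (simp add: A_def algebra_simps del: binomial_Suc_Suc)
  have 2: "int s * int ((i + t) choose j) = C"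
    using int_Suc_choose_Suc[of j "i + t"] by (simp add: C_def s_def algebra_simps del: binomial_Suc_Suc)
  have 3: "(int s - int j) * int (s choose j) = C"
    using int_choose_Suc[of j s] by (simp add: C_def)
  have 4: "(int j - int t) * int (Suc j choose Suc t) = (int j + 1) * int (j choose Suc t)"
    using int_Suc_choose[of j "Suc t"] by (simp add: algebra_simps del: binomial_Suc_Suc)
  have 5: "int (Suc j choose Suc t) = int (j choose t) + int (j choose Suc t)" by simp
  \<comment> \<open>Here \<open>i + j + 1 = s + (j - t)\<close>; Pascal's rule treats the first part
    and fact 4 the second.\<close>
  have 6: "(int i + int j + 1) * int (Suc j choose Suc t) =
      int s * int (j choose t) + (int s + int j + 1) * int (j choose Suc t)"
  proof -
    have "(int i + int j + 1) * int (Suc j choose Suc t) =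
        int s * int (Suc j choose Suc t) + (int j - int t) * int (Suc j choose Suc t)"
      by (simp add: s_def algebra_simps del: binomial_Suc_Suc)
    then show ?thesis unfolding 4 unfolding 5 by (simp add: algebra_simps)
  qed
  have "(int j + 1)\<^sup>2 * (int (Suc (i + j) choose i) * int (Suc j choose Suc t) * int (s choose Suc j)) =
      ((int j + 1) * int (Suc (i + j) choose i)) * int (Suc j choose Suc t) * C"
    by (simp add: C_def power2_eq_square del: binomial_Suc_Suc)
  also have "\<dots> = A * C * ((int i + int j + 1) * int (Suc j choose Suc t))"
    unfolding 1 by (simp only: mult_ac)
  also have "\<dots> = A * int (j choose t) * int s * C + A * int (j choose Suc t) * (int s + int j + 1) * C"
    unfolding 6 by (simp add: algebra_simps)
  also have "\<dots> = A * int (j choose t) * int s * (int s * int ((i + t) choose j)) +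
      A * int (j choose Suc t) * (int s + int j + 1) * ((int s - int j) * int (s choose j))"
    unfolding 2 3 ..
  finally show ?thesis by (simp add: A_def power2_eq_square algebra_simps)
qed

text \<open>Induction on \<open>j\<close>: multiplication by \<open>w - v j\<close> turns
  \<open>b j\<close> into \<open>(j + 1)^2 * b (j + 1)\<close> and sends each
  \<open>b (i + t)\<close> to a combination of itself and its successor. The coefficient recursions
  collect the result, and \<open>(j + 1)^2\<close> cancels.\<close>

lemma dbasis_mult_int:
  "int (dbasis i k) * int (dbasis j k) =
     (\<Sum>t\<le>j. int ((i + j) choose i) * int (j choose t) * int ((i + t) choose j) * int (dbasis (i + t) k))"
proof (induction j)
  case (Suc j)
  define b where "b l = int (dbasis l k)" for l
  define c where "c j t = int ((i + j) choose i) * int (j choose t) * int ((i + t) choose j)" for j t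
  define w where "w = int k * (int k + 1)"
  define v where "v l = int l * (int l + 1)" for l
  have b_rec: "(w - v j) * b l = (int (Suc l))\<^sup>2 * b (Suc l) + (v l - v j) * b l" for l j
    using dbasis_Suc[of l k] by (simp add: b_def w_def v_def algebra_simps)
  have rec0: "(int j + 1)\<^sup>2 * c (Suc j) 0 = c j 0 * (v i - v j)"
    using dbasis_coeff_rec_0[of j i] by (simp add: c_def v_def del: binomial_Suc_Suc)
  have rec: "(int j + 1)\<^sup>2 * c (Suc j) (Suc t) =
      c j t * (int (Suc (i + t)))\<^sup>2 + c j (Suc t) * (v (i + Suc t) - v j)" for t
    using dbasis_coeff_rec_Suc[of j i t] unfolding c_def v_def
    by (simp only: add_Suc_right)
  \<comment> \<open>This zero coefficient lets the diagonal sum run up to \<open>Suc j\<close>, so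
    that it can be shifted against the other one.\<close>
  have c0: "c j (Suc j) = 0" by (simp add: c_def)
  have "(int j + 1)\<^sup>2 * (b i * b (Suc j)) = b i * ((int j + 1)\<^sup>2 * b (Suc j))"
    by (simp only: mult_ac)
  also have "\<dots> = b i * ((w - v j) * b j)"
    using dbasis_Suc[of j k] by (simp only: b_def w_def v_def)
  also have "\<dots> = (w - v j) * (\<Sum>t\<le>j. c j t * b (i + t))"
    unfolding b_def c_def Suc.IH[symmetric] by (simp only: mult_ac)
  also have "\<dots> = (\<Sum>t\<le>j. c j t * ((w - v j) * b (i + t)))"
    by (simp add: sum_distrib_left mult_ac)
  also have "\<dots> = (\<Sum>t\<le>j. c j t * (int (Suc (i + t)))\<^sup>2 * b (i + Suc t)) +
      (\<Sum>t\<le>Suc j. c j t * (v (i + t) - v j) * b (i + t))"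
    unfolding b_rec by (simp add: c0 sum.distrib distrib_left mult_ac)
  also have "\<dots> = c j 0 * (v i - v j) * b i + (\<Sum>t\<le>j. c j t * (int (Suc (i + t)))\<^sup>2 * b (i + Suc t) +
      c j (Suc t) * (v (i + Suc t) - v j) * b (i + Suc t))"
    by (subst sum.atMost_Suc_shift) (simp add: sum.distrib)
  also have "\<dots> = (int j + 1)\<^sup>2 * c (Suc j) 0 * b i +
      (\<Sum>t\<le>j. (int j + 1)\<^sup>2 * c (Suc j) (Suc t) * b (i + Suc t))"
    unfolding rec rec0 by (simp only: distrib_right)
  also have "\<dots> = (int j + 1)\<^sup>2 * (\<Sum>t\<le>Suc j. c (Suc j) t * b (i + t))"
    by (subst sum.atMost_Suc_shift) (simp add: sum_distrib_left distrib_left mult_ac)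
  finally have "(int j + 1)\<^sup>2 * (b i * b (Suc j)) = (int j + 1)\<^sup>2 * (\<Sum>t\<le>Suc j. c (Suc j) t * b (i + t))" .
  moreover have "(int j + 1)\<^sup>2 \<noteq> 0" by simp
  ultimately have "b i * b (Suc j) = (\<Sum>t\<le>Suc j. c (Suc j) t * b (i + t))"
    using mult_cancel_left by blast
  then show ?case unfolding b_def c_def .
qed simp

lemma dbasis_mult:
  "dbasis i k * dbasis j k =
     (\<Sum>t\<le>j. ((i + j) choose i) * (j choose t) * ((i + t) choose j) * dbasis (i + t) k)"
proof -
  have "int (dbasis i k * dbasis j k) =
      int (\<Sum>t\<le>j. ((i + j) choose i) * (j choose t) * ((i + t) choose j) * dbasis (i + t) k)"
    using dbasis_mult_int[of i k j] by simp
  then show ?thesis by (simp only: of_nat_eq_iff)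
qed

section \<open>The ring spanned by the basis\<close>

text \<open>Built one term at a time, so that linear facts follow by rule induction. The scalars
  \<open>p\<close> are constant in \<open>k\<close>; later they are integer polynomials in
  \<open>x\<close>.\<close>

inductive_set dspan :: "(nat \<Rightarrow> 'a :: comm_ring_1) set" where
  zero: "(\<lambda>k. 0) \<in> dspan"
| step: "f \<in> dspan \<Longrightarrow> (\<lambda>k. f k + p * of_nat (dbasis l k)) \<in> dspan"

lemma dspan_basis: "(\<lambda>k. p * of_nat (dbasis l k)) \<in> dspan"
  using dspan.step[OF dspan.zero, of p l] by simp

lemma dspan_const: "(\<lambda>k. p) \<in> dspan"
  using dspan_basis[of p 0] by simp

lemma dspan_add: "g \<in> dspan \<Longrightarrow> f \<in> dspan \<Longrightarrow> (\<lambda>k. f k + g k) \<in> dspan"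
proof (induction g rule: dspan.induct)
  case (step g p l)
  then show ?case using dspan.step[of "\<lambda>k. f k + g k" p l] by (simp add: add.assoc)
qed simp

lemma dspan_sum: "(\<And>i. i \<in> I \<Longrightarrow> f i \<in> dspan) \<Longrightarrow> (\<lambda>k. \<Sum>i\<in>I. f i k) \<in> dspan"
  by (induction I rule: infinite_finite_induct) (auto intro: dspan_add dspan.zero)

lemma dspan_scale: "f \<in> dspan \<Longrightarrow> (\<lambda>k. p * f k) \<in> dspan"
proof (induction f rule: dspan.induct)
  case (step f q l)
  then show ?case using dspan.step[of "\<lambda>k. p * f k" "p * q" l] by (simp add: algebra_simps)
qed (simp add: dspan.zero)

text \<open>Closure under products rests on the integrality of the coefficients in
  \<open>dbasis_mult\<close>.\<close>

lemma dspan_mult_basis: "f \<in> dspan \<Longrightarrow> (\<lambda>k. f k * of_nat (dbasis j k)) \<in> dspan"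
proof (induction f rule: dspan.induct)
  case (step f p i)
  have "(\<lambda>k. \<Sum>t\<le>j. of_nat (((i + j) choose i) * (j choose t) * ((i + t) choose j)) *
      of_nat (dbasis (i + t) k) :: 'a) \<in> dspan"
    by (intro dspan_sum dspan_basis)
  then have "(\<lambda>k. of_nat (dbasis i k * dbasis j k) :: 'a) \<in> dspan"
    unfolding dbasis_mult by simp
  from dspan_add[OF dspan_scale[OF this, of p] step.IH] show ?case
    by (simp add: algebra_simps)
qed (simp add: dspan.zero)

lemma dspan_mult: "g \<in> dspan \<Longrightarrow> f \<in> dspan \<Longrightarrow> (\<lambda>k. f k * g k) \<in> dspan"
proof (induction g rule: dspan.induct)
  case (step g p l)
  from dspan_add[OF dspan_scale[OF dspan_mult_basis[OF step.prems, of l], of p] step.IH[OF step.prems]]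
  show ?case by (simp add: algebra_simps)
qed (simp add: dspan.zero)

lemma dspan_power: "f \<in> dspan \<Longrightarrow> (\<lambda>k. f k ^ m) \<in> dspan"
  by (induction m) (simp_all add: dspan_const dspan_mult)

section \<open>Constants plus twice the span\<close>

definition dspan2 :: "(nat \<Rightarrow> 'a :: comm_ring_1) set" where
  "dspan2 = {f. \<exists>p. \<exists>g\<in>dspan. f = (\<lambda>k. p + 2 * g k)}"

lemma dspan2I: "g \<in> dspan \<Longrightarrow> (\<And>k. f k = p + 2 * g k) \<Longrightarrow> f \<in> dspan2"
  by (auto simp: dspan2_def)

lemma dspan2_const: "(\<lambda>k. p) \<in> dspan2"
  by (rule dspan2I[OF dspan.zero, of _ p]) simp

lemma dspan2_double: "g \<in> dspan \<Longrightarrow> (\<lambda>k. 2 * g k) \<in> dspan2"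
  by (erule dspan2I[of _ _ 0]) simp

lemma dspan2_add:
  assumes "f \<in> dspan2" "g \<in> dspan2"
  shows "(\<lambda>k. f k + g k) \<in> dspan2"
proof -
  from assms obtain p f' q g' where "f' \<in> dspan" "g' \<in> dspan"
    "f = (\<lambda>k. p + 2 * f' k)" "g = (\<lambda>k. q + 2 * g' k)"
    unfolding dspan2_def by blast
  then show ?thesis
    by (intro dspan2I[where p = "p + q", OF dspan_add[of g' f']]) (auto simp: algebra_simps)
qed

lemma dspan2_mult:
  assumes "f \<in> dspan2" "g \<in> dspan2"
  shows "(\<lambda>k. f k * g k) \<in> dspan2"
proof -
  from assms obtain p f' q g' where *: "f' \<in> dspan" "g' \<in> dspan"
    "f = (\<lambda>k. p + 2 * f' k)" "g = (\<lambda>k. q + 2 * g' k)"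
    unfolding dspan2_def by blast
  have "(\<lambda>k. p * g' k + (q * f' k + 2 * (f' k * g' k))) \<in> dspan"
    by (intro dspan_add dspan_scale dspan_mult *)
  then show ?thesis
    by (rule dspan2I[where p = "p * q"]) (auto simp: * algebra_simps)
qed

lemma dspan2_scale: "f \<in> dspan2 \<Longrightarrow> (\<lambda>k. p * f k) \<in> dspan2"
  using dspan2_mult[OF dspan2_const] .

lemma dspan2_sum: "(\<And>i. i \<in> I \<Longrightarrow> f i \<in> dspan2) \<Longrightarrow> (\<lambda>k. \<Sum>i\<in>I. f i k) \<in> dspan2"
  by (induction I rule: infinite_finite_induct) (auto intro: dspan2_add dspan2_const)

lemma dspan2_power: "f \<in> dspan2 \<Longrightarrow> (\<lambda>k. f k ^ m) \<in> dspan2"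
  by (induction m) (simp_all add: dspan2_const dspan2_mult)

text \<open>Pascal's rule splits the central binomial coefficient into two equal terms.\<close>

lemma even_central_binomial:
  assumes "l > 0"
  shows "even ((2 * l) choose l)"
proof -
  obtain r where r: "l = Suc r" using assms gr0_implies_Suc by blast
  have "(2 * l) choose l = (Suc (2 * r) choose r) + (Suc (2 * r) choose Suc r)"
    by (simp add: r)
  moreover have "Suc (2 * r) choose Suc r = Suc (2 * r) choose r"
    using binomial_symmetric[of r "Suc (2 * r)"] by simp
  ultimately show ?thesis by simp
qed

text \<open>For \<open>i = j = l\<close> every coefficient in \<open>dbasis_mult\<close> contains
  the even number \<open>(2 * l) choose l\<close>.\<close>

lemma dbasis_square:
  assumes "l > 0"
  obtains g :: "nat \<Rightarrow> 'a :: comm_ring_1"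
    where "g \<in> dspan" "\<And>k. of_nat (dbasis l k) ^ 2 = 2 * g k"
proof -
  obtain e where e: "(l + l) choose l = 2 * e"
    using even_central_binomial[OF assms] by (auto simp: mult_2)
  define g :: "nat \<Rightarrow> 'a" where
    "g k = (\<Sum>t\<le>l. of_nat (e * (l choose t) * ((l + t) choose l)) * of_nat (dbasis (l + t) k))" for k
  have "g \<in> dspan" unfolding g_def by (intro dspan_sum dspan_basis)
  moreover have "of_nat (dbasis l k) ^ 2 = 2 * g k" for k
  proof -
    have "of_nat (dbasis l k) ^ 2 = (of_nat (dbasis l k * dbasis l k) :: 'a)"
      by (simp add: power2_eq_square)
    also have "\<dots> = 2 * g k"
      unfolding dbasis_mult e g_def by (simp add: sum_distrib_left mult_ac)
    finally show ?thesis .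
  qed
  ultimately show ?thesis using that by blast
qed

text \<open>For \<open>l > 0\<close> a square splits off and supplies the factor 2; for
  \<open>l = 0\<close> the power is the constant 1.\<close>

lemma dbasis_power_dspan2:
  assumes "h \<ge> 2"
  shows "(\<lambda>k. of_nat (dbasis l k) ^ h :: 'a :: comm_ring_1) \<in> dspan2"
proof (cases "l = 0")
  case False
  then obtain g :: "nat \<Rightarrow> 'a" where g: "g \<in> dspan" "\<And>k. of_nat (dbasis l k) ^ 2 = 2 * g k"
    using dbasis_square by blast
  have "(\<lambda>k. g k * of_nat (dbasis l k) ^ (h - 2)) \<in> dspan"
    using dspan_basis[of 1 l] by (intro dspan_mult dspan_power g) simp
  moreover have "of_nat (dbasis l k) ^ h = 2 * (g k * of_nat (dbasis l k) ^ (h - 2))" for k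
    using power_add[of "of_nat (dbasis l k) :: 'a" 2 "h - 2"] assms
    unfolding g(2) by (simp only: le_add_diff_inverse mult.assoc)
  ultimately show ?thesis
    by (intro dspan2I[where p = 0]) auto
qed (simp add: dspan2_const)

text \<open>In the square of a combination the cross terms are even, and the squares of basis
  elements are already covered. This serves even exponents \<open>m\<close>.\<close>

lemma dspan_square_dspan2: "f \<in> dspan \<Longrightarrow> (\<lambda>k. f k ^ 2) \<in> dspan2"
proof (induction f rule: dspan.induct)
  case (step f p l)
  have "(\<lambda>k. f k ^ 2 + (2 * (p * (f k * of_nat (dbasis l k))) + p ^ 2 * of_nat (dbasis l k) ^ 2))
      \<in> dspan2"
    by (intro dspan2_add step.IH dspan2_double dspan_scale dspan_mult_basis step.hyps dspan2_scale
        dbasis_power_dspan2) simp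
  then show ?case by (simp add: power2_eq_square algebra_simps)
qed (simp add: dspan2_const)

section \<open>Alternating sums and their divisibility\<close>

lemma alternating_sum_dbasis:
  "(\<Sum>k\<le>n. (-1) ^ k * (int k * (int k + 1) * (2 * int k + 1)) * int (dbasis l k)) =
     (-1) ^ n * ((int n + 1) * int (n choose l) * int ((n + l + 1) choose l)) *
       (int n * (int n + 2) - int l)"
proof (induction n)
  case 0
  show ?case by (cases l) simp_all
next
  case (Suc n)
  \<comment> \<open>The new summand contains \<open>U\<close>, and the closed forms at
    \<open>n\<close> and \<open>Suc n\<close> are both multiples of it, so the induction step
    becomes a polynomial identity.\<close>
  define U where "U = int (Suc n choose l) * int (Suc (n + l) choose l)"
  have 1: "(int n + 1) * int (n choose l) * int ((n + l + 1) choose l) = (int n + 1 - int l) * U"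
    using int_Suc_choose[of n l] by (simp add: U_def mult.assoc del: binomial_Suc_Suc)
  have "(int n + 2) * int (Suc (Suc (n + l)) choose l) = (int n + int l + 2) * int (Suc (n + l) choose l)"
    using int_Suc_choose[of "Suc (n + l)" l] by (simp add: algebra_simps del: binomial_Suc_Suc)
  from arg_cong[OF this, of "\<lambda>x. int (Suc n choose l) * x"]
  have 2: "(int (Suc n) + 1) * int (Suc n choose l) * int ((Suc n + l + 1) choose l) =
      (int n + int l + 2) * U"
    by (simp add: U_def algebra_simps del: binomial_Suc_Suc)
  have 3: "int (dbasis l (Suc n)) = U"
    by (simp add: dbasis_def U_def del: binomial_Suc_Suc)
  have "(-1) ^ n * ((int n + 1 - int l) * U) * (int n * (int n + 2) - int l) +
      (-1) ^ Suc n * (int (Suc n) * (int (Suc n) + 1) * (2 * int (Suc n) + 1)) * U =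
      (-1) ^ Suc n * ((int n + int l + 2) * U) * (int (Suc n) * (int (Suc n) + 2) - int l)"
    by (simp add: algebra_simps)
  then show ?case
    unfolding sum.atMost_Suc Suc.IH 1 2 3 .
qed

text \<open>Absorbing \<open>l\<close> into the first binomial coefficient releases
  \<open>n\<close>; absorbing it into the second releases \<open>n + 2\<close>.\<close>

lemma choose_product_dvd:
  fixes n l :: nat
  defines "Y \<equiv> int l * int (n choose l) * int ((n + l + 1) choose l)"
  shows "int n dvd Y" and "int n + 2 dvd Y"
proof -
  show "int n dvd Y"
  proof (cases "n = 0 \<or> l = 0")
    case False
    then obtain m r where "n = Suc m" "l = Suc r" by (metis not0_implies_Suc)
    then have "int l * int (n choose l) = int n * int (m choose r)"
      using int_Suc_choose_Suc[of r m] by (simp add: add.commute del: binomial_Suc_Suc)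
    then show ?thesis by (simp add: Y_def)
  qed (auto simp: Y_def)
  show "int n + 2 dvd Y"
  proof (cases l)
    case (Suc r)
    have "int l * int ((n + l + 1) choose l) = (int n + 2) * int ((n + l + 1) choose r)"
      using int_choose_Suc[of r "n + l + 1"] by (simp add: Suc algebra_simps del: binomial_Suc_Suc)
    then have "Y = (int n + 2) * (int ((n + l + 1) choose r) * int (n choose l))"
      by (simp add: Y_def mult_ac)
    then show ?thesis by simp
  qed (simp add: Y_def)
qed

text \<open>The weight takes one copy of \<open>k * (k + 1)\<close> from the \<open>a\<close>-th
  power, leaving the exponent \<open>a - 1\<close> for \<open>f\<close>. The term at 0
  vanishes.\<close>

definition wsum :: "nat \<Rightarrow> (nat \<Rightarrow> 'a :: comm_ring_1) \<Rightarrow> 'a" where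
  "wsum n f = (\<Sum>k\<le>n. (-1) ^ k * of_nat (k * (k + 1) * (2 * k + 1)) * f k)"

lemma wsum_add: "wsum n (\<lambda>k. f k + g k) = wsum n f + wsum n g"
  by (simp add: wsum_def distrib_left sum.distrib)

lemma wsum_scale: "wsum n (\<lambda>k. p * f k) = p * wsum n f"
  by (simp add: wsum_def sum_distrib_left mult_ac)

text \<open>The closed form is a multiple of \<open>n + 1\<close>, so the question is whether
  \<open>n * (n + 2)\<close> divides the correction \<open>Y\<close>. It divides
  \<open>n * Y\<close> and \<open>(n + 2) * Y\<close>, hence \<open>2 * Y\<close>.\<close>

lemma wsum_dbasis_dvd:
  shows "int (n * (n + 1) * (n + 2)) dvd 2 * wsum n (\<lambda>k. int (dbasis l k))"
    and "odd n \<or> l \<le> 1 \<Longrightarrow> int (n * (n + 1) * (n + 2)) dvd wsum n (\<lambda>k. int (dbasis l k))"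
proof -
  define C where "C = int (n choose l) * int ((n + l + 1) choose l)"
  define Y where "Y = int l * C"
  let ?N = "int n * (int n + 2)"
  have sum: "wsum n (\<lambda>k. int (dbasis l k)) = (-1) ^ n * ((int n + 1) * (?N * C - Y))"
  proof -
    have "wsum n (\<lambda>k. int (dbasis l k)) =
        (\<Sum>k\<le>n. (-1) ^ k * (int k * (int k + 1) * (2 * int k + 1)) * int (dbasis l k))"
      by (simp add: wsum_def algebra_simps)
    then show ?thesis
      unfolding alternating_sum_dbasis by (simp add: C_def Y_def algebra_simps)
  qed
  have N: "int (n * (n + 1) * (n + 2)) = (int n + 1) * ?N" by (simp add: algebra_simps)
  have dvd: "int n dvd Y" "int n + 2 dvd Y"
    using choose_product_dvd[of n l] by (simp_all add: Y_def C_def mult.assoc)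
  have Yn: "?N dvd int n * Y" using dvd(2) by simp
  have "?N dvd (int n + 2) * Y" using mult_dvd_mono[OF dvd(1) dvd_refl[of "int n + 2"]] by (simp add: mult.commute)
  from dvd_diff[OF this Yn] have Y2: "?N dvd 2 * Y" by (simp add: algebra_simps)
  have "?N dvd 2 * (?N * C - Y)"
    unfolding right_diff_distrib by (rule dvd_diff[OF dvd_mult[OF dvd_triv_left] Y2])
  from mult_dvd_mono[OF dvd_refl[of "int n + 1"] this]
  have "int (n * (n + 1) * (n + 2)) dvd (-1) ^ n * ((int n + 1) * (2 * (?N * C - Y)))"
    unfolding N by (rule dvd_mult)
  then show "int (n * (n + 1) * (n + 2)) dvd 2 * wsum n (\<lambda>k. int (dbasis l k))"
    unfolding sum by (simp only: mult_ac)
  assume "odd n \<or> l \<le> 1"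
  then have "?N dvd Y"
  proof
    assume "odd n"
    then obtain r where "n = 2 * r + 1" by (elim oddE)
    \<comment> \<open>For \<open>n = 2 * r + 1\<close>, the multiples \<open>n * Y\<close> and
      \<open>2 * Y\<close> of \<open>n * (n + 2)\<close> combine to \<open>Y\<close> itself.\<close>
    then have "int n * Y - int r * (2 * Y) = Y" by (simp add: algebra_simps)
    with dvd_diff[OF Yn dvd_mult[OF Y2, of "int r"]] show ?thesis by argo
  next
    assume "l \<le> 1"
    then consider "l = 0" | "l = 1" by linarith
    \<comment> \<open>\<open>Y\<close> is 0 for \<open>l = 0\<close> and equals
      \<open>n * (n + 2)\<close> for \<open>l = 1\<close>.\<close>
    then show ?thesis by cases (simp_all add: Y_def C_def add.commute)
  qed
  then have "?N dvd ?N * C - Y" by (simp add: dvd_diff)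
  from mult_dvd_mono[OF dvd_refl[of "int n + 1"] this]
  show "int (n * (n + 1) * (n + 2)) dvd wsum n (\<lambda>k. int (dbasis l k))"
    unfolding N sum by (rule dvd_mult)
qed

lemma of_int_wsum: "of_int (wsum n (\<lambda>k. int (f k))) = wsum n (\<lambda>k. of_nat (f k))"
  by (simp add: wsum_def)

lemma of_int_dvd_of_int: "a dvd b \<Longrightarrow> (of_int a :: 'a :: comm_ring_1) dvd of_int b"
  by (auto simp: dvd_def)

text \<open>Integer divisibility is carried by \<open>of_int\<close> into any commutative ring, in
  particular into \<open>int poly\<close>.\<close>

lemma wsum_dbasis_dvd':
  shows "(of_nat (n * (n + 1) * (n + 2)) :: 'a :: comm_ring_1)
      dvd 2 * wsum n (\<lambda>k. of_nat (dbasis l k))"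
    and "odd n \<or> l \<le> 1 \<Longrightarrow> (of_nat (n * (n + 1) * (n + 2)) :: 'a)
      dvd wsum n (\<lambda>k. of_nat (dbasis l k))"
proof -
  show "(of_nat (n * (n + 1) * (n + 2)) :: 'a) dvd 2 * wsum n (\<lambda>k. of_nat (dbasis l k))"
    using of_int_dvd_of_int[OF wsum_dbasis_dvd(1)[of n l], where 'a = 'a]
    by (simp only: of_int_mult of_int_numeral of_int_of_nat_eq of_int_wsum)
  show "(of_nat (n * (n + 1) * (n + 2)) :: 'a) dvd wsum n (\<lambda>k. of_nat (dbasis l k))"
    if "odd n \<or> l \<le> 1"
    using of_int_dvd_of_int[OF wsum_dbasis_dvd(2)[OF that], where 'a = 'a]
    by (simp only: of_int_of_nat_eq of_int_wsum)
qed

lemma wsum_dspan_dvd: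
  assumes "f \<in> dspan"
  shows "of_nat (n * (n + 1) * (n + 2)) dvd 2 * wsum n f"
  using assms
proof (induction f rule: dspan.induct)
  case (step f p l)
  have "2 * wsum n (\<lambda>k. f k + p * of_nat (dbasis l k)) =
      2 * wsum n f + p * (2 * wsum n (\<lambda>k. of_nat (dbasis l k)))"
    by (simp add: wsum_add wsum_scale algebra_simps)
  then show ?case using dvd_add[OF step.IH dvd_mult[OF wsum_dbasis_dvd'(1)]] by (simp only:)
qed (simp add: wsum_def)

lemma wsum_dspan_dvd_odd:
  assumes "f \<in> dspan" "odd n"
  shows "of_nat (n * (n + 1) * (n + 2)) dvd wsum n f"
  using assms(1)
proof (induction f rule: dspan.induct)
  case (step f p l)
  then show ?case
    unfolding wsum_add wsum_scale using assms(2) by (intro dvd_add dvd_mult wsum_dbasis_dvd'(2)) auto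
qed (simp add: wsum_def)

text \<open>With \<open>f = p + 2 * g\<close>, the part with \<open>g\<close> supplies the factor 2
  demanded by \<open>wsum_dspan_dvd\<close>; the constant part reduces to the powers of
  \<open>w\<close> alone.\<close>

lemma wsum_dspan2_dvd:
  fixes f :: "nat \<Rightarrow> 'a :: comm_ring_1"
  assumes "f \<in> dspan2"
  shows "of_nat (n * (n + 1) * (n + 2)) dvd wsum n (\<lambda>k. of_nat (k * (k + 1)) ^ a * f k)"
proof -
  let ?w = "\<lambda>k. of_nat (dbasis 1 k) :: 'a"
  obtain p g where g: "g \<in> dspan" "f = (\<lambda>k. p + 2 * g k)"
    using assms unfolding dspan2_def by blast
  have w: "?w \<in> dspan" using dspan_basis[of 1 1] by simp
  \<comment> \<open>The powers 0 and 1 of \<open>w\<close> are the basis elements with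
    \<open>l <= 1\<close>; from the square on, a factor 2 appears.\<close>
  have pow: "of_nat (n * (n + 1) * (n + 2)) dvd wsum n (\<lambda>k. ?w k ^ a)"
  proof (cases "a \<le> 1")
    case True
    then consider "a = 0" | "a = 1" by linarith
    then show ?thesis
      using wsum_dbasis_dvd'(2)[of n 0] wsum_dbasis_dvd'(2)[of n 1] by cases simp_all
  next
    case False
    obtain g :: "nat \<Rightarrow> 'a" where g: "g \<in> dspan" "\<And>k. ?w k ^ 2 = 2 * g k"
      using dbasis_square[of 1] by auto
    from False have "2 \<le> a" by simp
    then have "?w k ^ a = 2 * (g k * ?w k ^ (a - 2))" for k
      using power_add[of "?w k" 2 "a - 2"]
      unfolding g(2) by (simp only: le_add_diff_inverse mult.assoc)
    moreover have "(\<lambda>k. g k * ?w k ^ (a - 2)) \<in> dspan"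
      by (intro dspan_mult dspan_power g w)
    ultimately show ?thesis
      using wsum_dspan_dvd by (simp add: wsum_scale)
  qed
  have "(\<lambda>k. ?w k ^ a * g k) \<in> dspan"
    by (intro dspan_mult dspan_power g w)
  note dvd = wsum_dspan_dvd[OF this, of n]
  have "wsum n (\<lambda>k. ?w k ^ a * f k) = p * wsum n (\<lambda>k. ?w k ^ a) + 2 * wsum n (\<lambda>k. ?w k ^ a * g k)"
    unfolding g(2) wsum_scale[symmetric] wsum_add[symmetric] by (simp add: algebra_simps)
  then have "of_nat (n * (n + 1) * (n + 2)) dvd wsum n (\<lambda>k. ?w k ^ a * f k)"
    using dvd_add[OF dvd_mult[OF pow] dvd] by (simp only:)
  then show ?thesis by (simp only: dbasis_1)
qed

section \<open>Transfer between integer and rational polynomials\<close>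

definition int_delannoy :: "nat \<Rightarrow> nat \<Rightarrow> int poly" where
  "int_delannoy h k = (\<Sum>l\<le>k. monom 1 l * of_nat (dbasis l k) ^ h)"

abbreviation rat_poly_of_int_poly :: "int poly \<Rightarrow> rat poly" where
  "rat_poly_of_int_poly \<equiv> map_poly of_int"

lemma rat_poly_add [simp]:
  "rat_poly_of_int_poly (p + q) = rat_poly_of_int_poly p + rat_poly_of_int_poly q"
  by (rule poly_eqI) (simp add: coeff_map_poly)

lemma rat_poly_mult [simp]:
  "rat_poly_of_int_poly (p * q) = rat_poly_of_int_poly p * rat_poly_of_int_poly q"
  by (rule poly_eqI) (simp add: coeff_map_poly coeff_mult)

lemma rat_poly_sum: "rat_poly_of_int_poly (sum f A) = (\<Sum>i\<in>A. rat_poly_of_int_poly (f i))"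
  by (induction A rule: infinite_finite_induct) simp_all

lemma rat_poly_power: "rat_poly_of_int_poly (p ^ m) = rat_poly_of_int_poly p ^ m"
  by (induction m) simp_all

lemma rat_poly_of_int: "rat_poly_of_int_poly (of_int c) = of_int c"
  by (simp add: of_int_poly map_poly_pCons)

lemma rat_poly_of_nat: "rat_poly_of_int_poly (of_nat c) = of_nat c"
  using rat_poly_of_int[of "int c"] by simp

lemma rat_poly_int_delannoy: "rat_poly_of_int_poly (int_delannoy h k) = gen_delannoy h k"
proof -
  have "monom 1 l * of_nat (dbasis l k) ^ h =
      monom (of_nat (((k + l) choose (2 * l)) ^ h * ((2 * l) choose l) ^ h) :: rat) l" if "l \<le> k" for l
  proof -
    have "(of_nat (dbasis l k) ^ h :: rat poly) = [:of_nat (dbasis l k ^ h):]"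
      unfolding of_nat_power[symmetric] unfolding of_nat_poly ..
    then show ?thesis
      by (simp add: dbasis_alt[OF that] smult_monom power_mult_distrib)
  qed
  then show ?thesis
    unfolding gen_delannoy_def int_delannoy_def rat_poly_sum
    by (auto simp: rat_poly_power rat_poly_of_nat map_poly_monom atMost_atLeast0 intro!: sum.cong)
qed

lemma wsum_cong: "(\<And>k. k \<le> n \<Longrightarrow> f k = g k) \<Longrightarrow> wsum n f = wsum n g"
  by (simp add: wsum_def)

text \<open>Membership in the span needs a range of summation independent of \<open>k\<close>. The
  added terms are \<open>0 ^ h\<close> with \<open>h > 0\<close>.\<close>

lemma int_delannoy_truncate:
  assumes "k \<le> n" "h > 0"
  shows "int_delannoy h k = (\<Sum>l\<le>n. monom 1 l * of_nat (dbasis l k) ^ h)"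
  unfolding int_delannoy_def
  by (rule sum.mono_neutral_left) (use assms in \<open>auto simp: dbasis_eq_0\<close>)

lemma rat_wsum_delannoy:
  assumes "a > 0"
  shows "(\<Sum>k=1..n. smult ((-1) ^ k * of_nat (k ^ a * (k + 1) ^ a * (2 * k + 1))) (gen_delannoy h k ^ m)) =
    rat_poly_of_int_poly (wsum n (\<lambda>k. of_nat (k * (k + 1)) ^ (a - 1) * int_delannoy h k ^ m))"
proof -
  have 1: "rat_poly_of_int_poly ((-1) ^ k * of_nat (k * (k + 1) * (2 * k + 1)) *
      (of_nat (k * (k + 1)) ^ (a - 1) * int_delannoy h k ^ m)) =
      smult ((-1) ^ k * of_nat (k ^ a * (k + 1) ^ a * (2 * k + 1))) (gen_delannoy h k ^ m)" for k
  proof -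
    obtain c where a: "a = Suc c" using assms gr0_implies_Suc by blast
    have *: "k ^ a * (k + 1) ^ a * (2 * k + 1) = k * (k + 1) * (2 * k + 1) * (k * (k + 1)) ^ (a - 1)"
      by (simp only: a power_mult_distrib power_Suc diff_Suc_1 mult_ac)
    have "(-1) ^ k * of_nat (k * (k + 1) * (2 * k + 1)) * (of_nat (k * (k + 1)) ^ (a - 1) * int_delannoy h k ^ m)
      = of_int ((-1) ^ k * int (k ^ a * (k + 1) ^ a * (2 * k + 1))) * int_delannoy h k ^ m"
      unfolding * by (simp only: of_int_mult of_int_power of_int_of_nat_eq of_nat_mult of_nat_power
          of_int_minus of_int_1 mult_ac)
    then show ?thesis
      by (simp only: rat_poly_mult rat_poly_power rat_poly_of_int rat_poly_int_delannoy)
         (simp add: of_int_poly)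
  qed
  \<comment> \<open>The sums differ only in the term at 0, which vanishes because
    \<open>a > 0\<close>.\<close>
  have "{..n} - {1..n} = {0}" by auto
  then show ?thesis
    unfolding wsum_def rat_poly_sum 1
    using assms by (intro sum.mono_neutral_left) (simp_all add: Suc_leI subset_eq)
qed

text \<open>The quotient of the divisibility in \<open>int poly\<close> is the integer polynomial
  sought.\<close>

lemma smult_int_polys:
  assumes "(of_nat N :: int poly) dvd of_nat c * p" "N > 0"
  shows "smult (of_nat c / of_nat N) (rat_poly_of_int_poly p) \<in> int_polys"
proof -
  obtain q where "of_nat c * p = of_nat N * q" using assms(1) by (elim dvdE)
  then have "rat_poly_of_int_poly (of_nat c * p) = rat_poly_of_int_poly (of_nat N * q)" by simp
  then have "smult (of_nat c) (rat_poly_of_int_poly p) = smult (of_nat N) (rat_poly_of_int_poly q)"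
    unfolding rat_poly_mult rat_poly_of_nat by (simp add: of_nat_poly)
  then have "smult (1 / of_nat N) (smult (of_nat c) (rat_poly_of_int_poly p)) =
      smult (1 / of_nat N) (smult (of_nat N) (rat_poly_of_int_poly q))" by simp
  then show ?thesis using assms(2) by (simp add: int_polys_def)
qed

theorem theorem2p2:
  fixes h m n a :: nat
  assumes "h > 0" and "m > 0" and "n > 0" and "a > 0"
  shows "(h > 1 \<longrightarrow>
      smult (1 / of_nat (n * (n + 1) * (n + 2)))
        (\<Sum>k=1..n. smult ((-1) ^ k * of_nat (k ^ a * (k + 1) ^ a * (2 * k + 1)))
          (gen_delannoy h k ^ m)) \<in> int_polys) \<and>
    smult (of_nat (gcd 2 (gcd (m - 1) n)) / of_nat (n * (n + 1) * (n + 2)))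
      (\<Sum>k=1..n. smult ((-1) ^ k * of_nat (k ^ a * (k + 1) ^ a * (2 * k + 1)))
        (delannoy k ^ m)) \<in> int_polys"
proof -
  let ?N = "n * (n + 1) * (n + 2)"
  define D :: "nat \<Rightarrow> nat \<Rightarrow> int poly" where
    "D h k = (\<Sum>l\<le>n. monom 1 l * of_nat (dbasis l k) ^ h)" for h k
  let ?S = "\<lambda>h. wsum n (\<lambda>k. of_nat (k * (k + 1)) ^ (a - 1) * int_delannoy h k ^ m)"
  have S: "?S h = wsum n (\<lambda>k. of_nat (k * (k + 1)) ^ (a - 1) * D h k ^ m)" if "h > 0" for h
    by (rule wsum_cong) (simp add: int_delannoy_truncate[OF _ that] D_def)
  have N: "?N > 0" using assms by simp
  have "of_nat ?N dvd of_nat 1 * ?S h" if "h > 1"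
  proof -
    have "D h \<in> dspan2"
      unfolding D_def using that by (intro dspan2_sum dspan2_scale dbasis_power_dspan2) simp
    from wsum_dspan2_dvd[OF dspan2_power[OF this, of m], of n "a - 1"] show ?thesis
      using that S[of h] by simp
  qed
  from smult_int_polys[OF this N] have 1: "h > 1 \<longrightarrow>
      smult (1 / of_nat ?N) (rat_poly_of_int_poly (?S h)) \<in> int_polys"
    by simp
  have D1: "D 1 \<in> dspan"
    unfolding D_def power_one_right by (intro dspan_sum dspan_basis)
  have "(\<lambda>k. of_nat (dbasis 1 k) ^ (a - 1) * D 1 k ^ m) \<in> dspan"
    using dspan_basis[of 1 1] by (intro dspan_mult dspan_power D1) simp
  then have span: "(\<lambda>k. of_nat (k * (k + 1)) ^ (a - 1) * D 1 k ^ m) \<in> dspan"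
    by (simp only: dbasis_1)
  have "of_nat ?N dvd of_nat (gcd 2 (gcd (m - 1) n)) * ?S 1"
  \<comment> \<open>As \<open>m > 0\<close>, the gcd is 2 exactly when \<open>m\<close> is odd and
    \<open>n\<close> even; otherwise it is 1 and divisibility must hold without doubling.\<close>
  proof (cases "even m \<or> odd n")
    case False
    then have "gcd 2 (gcd (m - 1) n) = 2" using assms(2) by (simp add: gcd_nat.absorb1)
    then show ?thesis using wsum_dspan_dvd[OF span, of n] S[of 1] by simp
  next
    case True
    have "of_nat ?N dvd ?S 1"
    proof (cases "odd n")
      case False
      \<comment> \<open>With \<open>n\<close> even, \<open>m\<close> is even, and
        \<open>D 1 k ^ m\<close> is a power of the square of \<open>D 1 k\<close>.\<close>
      with True obtain r where r: "m = 2 * r" by auto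
      show ?thesis
        using wsum_dspan2_dvd[OF dspan2_power[OF dspan_square_dspan2[OF D1], of r], of n "a - 1"]
          S[of 1] by (simp add: r power_mult)
    qed (use wsum_dspan_dvd_odd[OF span, of n] S[of 1] in simp)
    then show ?thesis by (rule dvd_mult)
  qed
  from smult_int_polys[OF this N] 1 show ?thesis
    unfolding delannoy_eq_gen_delannoy rat_wsum_delannoy[OF assms(4)] by blast
qed

end
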